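(* Let $m\ge2$, $n\ge1$ and let $\varphi^{(n)}$ be as defined in the context. If $\varphi^{(n)}(v_1,\dots,v_n)=(\widetilde{\widetilde v}_1,\dots,\widetilde{\widetilde v}_n)$, then for each $i\in\{1,\dots,n\}$, $$v_i=\Bigl(\widetilde{\widetilde v}_i-\sum_{j=1}^{i-1}\widetilde{\widetilde v}_j\Bigr)\bmod m.$$ In particular $\varphi^{(n)}$ is a bijection with inverse given by this formula.
   Context: Fix $m\ge2$. Define maps $\varphi^{(n)}:\{0,\dots,m-1\}^n\to\{0,\dots,m-1\}^n$ recursively: $\varphi^{(1)}$ is the identity, and for $n\ge2$, $\varphi^{(n)}(v_1,v_2,\dots,v_n)=\bigl(v_1,\ \varphi^{(n-1)}((v_1+v_2)\bmod m,\dots,(v_1+v_n)\bmod m)\bigr)$. *)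

theory Defs
  imports Main
begin

definition residue_vectors :: "int \<Rightarrow> nat \<Rightarrow> int list set" where
  "residue_vectors m n = {v. length v = n \<and> set v \<subseteq> {0..<m}}"

text \<open>Vectors are lists, so the coordinate \<open>v\<^sub>i\<close> is \<open>v ! (i - 1)\<close>.
  The index 0 is a dummy case; the maps of interest are \<open>phi m n\<close> on
  \<open>residue_vectors m n\<close> for \<open>n \<ge> 1\<close>.\<close>

fun phi :: "int \<Rightarrow> nat \<Rightarrow> int list \<Rightarrow> int list" where
  "phi m 0 v = v"
| "phi m (Suc 0) v = v"
| "phi m (Suc (Suc n)) v = hd v # phi m (Suc n) (map (\<lambda>x. (hd v + x) mod m) (tl v))"

definition inverse_coord :: "int \<Rightarrow> int list \<Rightarrow> nat \<Rightarrow> int" where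
  "inverse_coord m w i = (w ! (i - 1) - (\<Sum>j = 1..i - 1. w ! (j - 1))) mod m"

end

theory Submission imports Defs begin

text \<open>Let w be the image of v, with first entry a. Then a is also the first entry of v, and
  the tail of w is the image, one dimension lower, of the tail of v shifted by a. By induction the
  formula recovers each shifted entry from the tail of w; undoing the shift subtracts a, which is
  exactly the first term of the full prefix sum of w. This is \<open>nth_eq_of_phi\<close>. The
  formula is thus a left inverse (\<open>map_inverse_coord_phi\<close>), so the map is injective,
  and an injective self-map of a finite set is bijective (\<open>bij_betw_phi\<close>).\<close>

lemma finite_residue_vectors: "finite (residue_vectors m n)"
  unfolding residue_vectors_def
  using finite_lists_length_eq[of "{0..<m}" n] by (simp add: conj_commute)

lemma residue_vectors_Suc_iff:
  "v \<in> residue_vectors m (Suc n) \<longleftrightarrow>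
    (\<exists>a u. v = a # u \<and> a \<in> {0..<m} \<and> u \<in> residue_vectors m n)"
  unfolding residue_vectors_def by (cases v) auto

lemma map_mod_in_residue_vectors:
  assumes "m > 0" "u \<in> residue_vectors m n"
  shows "map (\<lambda>x. f x mod m) u \<in> residue_vectors m n"
  using assms by (auto simp: residue_vectors_def)

lemma phi_in_residue_vectors:
  assumes "m > 0" "v \<in> residue_vectors m n"
  shows "phi m n v \<in> residue_vectors m n"
  using assms
proof (induction m n v rule: phi.induct)
  case (3 m n v)
  then obtain a u where v: "v = a # u" "a \<in> {0..<m}" "u \<in> residue_vectors m (Suc n)"
    by (auto simp: residue_vectors_Suc_iff[of v])
  with 3 have "phi m (Suc n) (map (\<lambda>x. (a + x) mod m) u) \<in> residue_vectors m (Suc n)"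
    by (simp add: map_mod_in_residue_vectors)
  with v show ?case by (simp add: residue_vectors_Suc_iff[of _ m "Suc n"])
qed auto

lemma nth_eq_of_phi:
  assumes "m > 0" "v \<in> residue_vectors m n" "k < n"
  shows "v ! k = (phi m n v ! k - (\<Sum>j<k. phi m n v ! j)) mod m"
  using assms
proof (induction m n v arbitrary: k rule: phi.induct)
  case (2 m v)
  then show ?case by (auto simp: residue_vectors_Suc_iff)
next
  case (3 m n v)
  then obtain a u where v: "v = a # u" "a \<in> {0..<m}" "u \<in> residue_vectors m (Suc n)"
    by (auto simp: residue_vectors_Suc_iff[of v])
  show ?case
  proof (cases k)
    case 0
    with v show ?thesis by simp
  next
    case (Suc l)
    define u' where "u' = map (\<lambda>x. (a + x) mod m) u"
    define w where "w = phi m (Suc n) u'"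
    have l: "l < length u"
      using v(3) 3(4) Suc by (simp add: residue_vectors_def)
    then have ul: "u ! l \<in> {0..<m}"
      using v(3) nth_mem[of l u] by (simp add: residue_vectors_def subset_iff)
    have "u' \<in> residue_vectors m (Suc n)"
      unfolding u'_def using 3(2) v(3) by (rule map_mod_in_residue_vectors)
    then have "u' ! l = (w ! l - (\<Sum>j<l. w ! j)) mod m"
      using "3.IH"[of l] 3(2,4) Suc v(1) by (simp add: u'_def w_def)
    then have "(a + u ! l) mod m = (w ! l - (\<Sum>j<l. w ! j)) mod m"
      using l by (simp add: u'_def)
    \<comment> \<open>Undo the shift by a inside the congruence.\<close>
    then have "(a + u ! l - a) mod m = (w ! l - (\<Sum>j<l. w ! j) - a) mod m"
      by (rule mod_diff_cong) simp
    \<comment> \<open>The entry \<open>u ! l\<close> is already reduced, so the mod on the left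
      disappears.\<close>
    then have "u ! l = (w ! l - (a + (\<Sum>j<l. w ! j))) mod m"
      using ul by (simp add: algebra_simps)
    \<comment> \<open>The image of v is \<open>a # w\<close>, so a is the term of index 0 in its
      prefix sum. The sum must therefore be split at its first term, not its last.\<close>
    then show ?thesis
      using v(1) Suc
      by (simp add: u'_def[symmetric] w_def[symmetric] sum.lessThan_Suc_shift del: sum.lessThan_Suc)
  qed
qed simp

text \<open>Passes from the one-based coordinates of the formula to the list indices used in the
  induction.\<close>

lemma inverse_coord_Suc: "inverse_coord m w (Suc k) = (w ! k - (\<Sum>j<k. w ! j)) mod m"
  unfolding inverse_coord_def
  by (simp add: sum.atLeast1_atMost_eq)

lemma map_inverse_coord_phi:
  assumes "m > 0" "v \<in> residue_vectors m n"
  shows "map (inverse_coord m (phi m n v)) [1..<Suc n] = v"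
  using assms nth_eq_of_phi[OF assms]
  by (intro nth_equalityI)
    (auto simp: residue_vectors_def inverse_coord_Suc simp del: upt_Suc)

text \<open>Surjectivity comes from finiteness: the left inverse gives injectivity, and an injective
  map of a finite set into itself is onto.\<close>

lemma bij_betw_phi:
  assumes "m > 0"
  shows "bij_betw (phi m n) (residue_vectors m n) (residue_vectors m n)"
proof -
  have "inj_on (phi m n) (residue_vectors m n)"
    using map_inverse_coord_phi[OF assms] by (rule inj_on_inverseI)
  moreover have "phi m n ` residue_vectors m n \<subseteq> residue_vectors m n"
    using phi_in_residue_vectors[OF assms] by blast
  ultimately show ?thesis
    using endo_inj_surj[OF finite_residue_vectors] by (simp add: bij_betw_def)
qed

theorem theorem4:
  fixes m :: int and n :: nat
  assumes "m \<ge> 2" and "n \<ge> 1"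
  shows "(\<forall>v \<in> residue_vectors m n. \<forall>w. phi m n v = w \<longrightarrow>
            (\<forall>i \<in> {1..n}. v ! (i - 1) = inverse_coord m w i))
       \<and> bij_betw (phi m n) (residue_vectors m n) (residue_vectors m n)
       \<and> (\<forall>w \<in> residue_vectors m n.
            inv_into (residue_vectors m n) (phi m n) w = map (inverse_coord m w) [1..<Suc n])"
proof (intro conjI ballI allI impI)
  have m: "m > 0" using assms by simp
  show bij: "bij_betw (phi m n) (residue_vectors m n) (residue_vectors m n)"
    using m by (rule bij_betw_phi)
  show "v ! (i - 1) = inverse_coord m w i"
    if "v \<in> residue_vectors m n" "phi m n v = w" "i \<in> {1..n}" for v w i
    using nth_eq_of_phi[OF m that(1), of "i - 1"] inverse_coord_Suc[of m w "i - 1"] that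
    by auto
  show "inv_into (residue_vectors m n) (phi m n) w = map (inverse_coord m w) [1..<Suc n]"
    if "w \<in> residue_vectors m n" for w
  proof -
    \<comment> \<open>By surjectivity w is the image of some v; both sides then equal v, so the left
      inverse is the two-sided one.\<close>
    have "w \<in> phi m n ` residue_vectors m n"
      using that unfolding bij_betw_imp_surj_on[OF bij] .
    then obtain v where w: "w = phi m n v" and v: "v \<in> residue_vectors m n"
      by (rule imageE)
    show ?thesis
      unfolding w bij_betw_inv_into_left[OF bij v] map_inverse_coord_phi[OF m v] ..
  qed
qed

end
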